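(* Let $A$ be any algorithm with the following properties: $A$ is given $N$, an accuracy parameter $\epsilon>0$, distinct values $0\le a_1<a_2<a_3<a_4\in\mathbb{Z}$, and access to i.i.d. draws from an unknown $\{a_1,a_2,a_3,a_4\}$-sum $\mathbf{S}^*$; and with probability at least $9/10$ algorithm $A$ outputs a hypothesis distribution $\tilde{\mathbf{S}}$ such that $d_{TV}(\tilde{\mathbf{S}},\mathbf{S}^* )\le\epsilon$. Then there are infinitely many quadruples $(a_1,a_2,a_3,a_4)$ such that for sufficiently large $N$, $A$ must use $\Omega(\log\log a_4)$ samples even when run with $\epsilon$ set to a (suitably small) positive absolute constant.
   Context: For a finite set $\mathcal{A}\subset\mathbb{Z}_{\ge 0}$, an $\mathcal{A}$-sum is a distribution $\mathbf{S}=\mathbf{X}_1+\cdots+\mathbf{X}_N$ where the $\mathbf{X}_i$ are mutually independent (not necessarily identically distributed) integer random variables with $\bigcup_i\mathrm{supp}(\mathbf{X}_i)\subseteq\mathcal{A}$. $d_{TV}$ denotes total variation distance. *)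

theory Defs
  imports "HOL-Probability.Probability"
begin

fun sum_indep_pmf :: "(nat \<Rightarrow> int pmf) \<Rightarrow> nat \<Rightarrow> int pmf" where
  "sum_indep_pmf Xs 0 = return_pmf 0"
| "sum_indep_pmf Xs (Suc n) =
     map_pmf (\<lambda>(x, y). x + y) (pair_pmf (sum_indep_pmf Xs n) (Xs n))"

definition is_A_sum :: "int set \<Rightarrow> nat \<Rightarrow> int pmf \<Rightarrow> bool" where
  "is_A_sum A N S \<longleftrightarrow>
     (\<exists>Xs. (\<forall>i<N. set_pmf (Xs i) \<subseteq> A) \<and> S = sum_indep_pmf Xs N)"

definition dTV :: "int pmf \<Rightarrow> int pmf \<Rightarrow> real" where
  "dTV p q = (\<Sum>\<^sub>\<infinity> x. \<bar>pmf p x - pmf q x\<bar>) / 2"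

fun iid_pmf :: "nat \<Rightarrow> 'a pmf \<Rightarrow> 'a list pmf" where
  "iid_pmf 0 p = return_pmf []"
| "iid_pmf (Suc m) p = bind_pmf p (\<lambda>x. map_pmf (\<lambda>xs. x # xs) (iid_pmf m p))"

text \<open>A (randomized) learning algorithm: on input (N, eps, (a1,a2,a3,a4)) it draws
  m N eps a samples and outputs a random hypothesis distribution alg N eps a samples.
  It is correct if for every valid input and every {a1..a4}-sum S with N summands,
  with probability at least 9/10 the hypothesis is eps-close to S in TV distance.\<close>
definition correct_learner ::
  "(nat \<Rightarrow> real \<Rightarrow> int \<times> int \<times> int \<times> int \<Rightarrow> nat) \<Rightarrow>
   (nat \<Rightarrow> real \<Rightarrow> int \<times> int \<times> int \<times> int \<Rightarrow> int list \<Rightarrow> int pmf pmf) \<Rightarrow> bool" where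
  "correct_learner m alg \<longleftrightarrow>
     (\<forall>N eps a1 a2 a3 a4 S.
        eps > 0 \<and> 0 \<le> a1 \<and> a1 < a2 \<and> a2 < a3 \<and> a3 < a4 \<and>
        is_A_sum {a1, a2, a3, a4} N S \<longrightarrow>
        measure_pmf.prob
          (bind_pmf (iid_pmf (m N eps (a1, a2, a3, a4)) S) (alg N eps (a1, a2, a3, a4)))
          {H. dTV H S \<le> eps} \<ge> 9 / 10)"

end

theory Submission
  imports Defs "HOL-Real_Asymp.Real_Asymp"
begin

text \<open>
  Let \<open>F\<close> be the Fibonacci-like sequence with \<open>F (n + 2) = a F (n + 1) + F n\<close> for a large constant
  \<open>a\<close>, and take the quadruple \<open>(0, 1, p, q) = (0, 1, F n, F (n + 1))\<close>. For \<open>0 < k < n\<close> the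
  hypothesis with index \<open>k\<close> is \<open>U + p V + q Y\<close>, where \<open>U\<close>, \<open>V\<close>, \<open>Y\<close> are fair binomials of standard deviation
  about \<open>F (n - k)\<close>, \<open>F k\<close>, and a huge number, respectively. The partial quotients of \<open>p / q\<close> are
  bounded, so the lattice \<open>{(u, v). q dvd u + p v}\<close> has no short vectors at any of the \<open>n - 1\<close>
  scales. This has two consequences. First, \<open>U + p V\<close> hits every residue class modulo \<open>q\<close> with
  probability \<open>O(1/q)\<close>, so, after smoothing by \<open>q Y\<close>, all hypotheses are dominated up to an absolute
  constant \<open>C\<close> by one reference distribution. Second, each hypothesis concentrates modulo \<open>q\<close> on a
  box which the hypotheses with wider \<open>U\<close> mostly miss, so the hypotheses are pairwise far apart.
  With \<open>m\<close> samples, domination bounds the sum of the success probabilities over all hypotheses by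
  \<open>C ^ m\<close>; hence \<open>9/10 (n - 1) \<le> C ^ m\<close>, where \<open>n\<close> is of order \<open>ln q\<close>.

  Both consequences are packing bounds. All translates of a fair binomial by at most about its
  standard deviation are dominated by one common distribution, so an event with disjoint translates
  has probability at most inversely proportional to their number.
\<close>

section \<open>Domination between distributions\<close>

lemma pmf_summable_on: "pmf p summable_on A"
  using abs_summable_equivalent[of "pmf p" A] pmf_abs_summable[of p A] by simp

lemma prob_eq_infsum: "measure_pmf.prob p A = infsum (pmf p) A"
  using infsetsum_infsum[OF pmf_abs_summable] by (simp add: measure_pmf_conv_infsetsum)

definition dominated :: "real \<Rightarrow> 'a pmf \<Rightarrow> 'a pmf \<Rightarrow> bool" where
  "dominated C p r \<longleftrightarrow> (\<forall>x. pmf p x \<le> C * pmf r x)"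

lemma dominated_refl: "dominated 1 p p"
  by (simp add: dominated_def)

lemma dominated_prob_le:
  assumes "dominated C p r"
  shows "measure_pmf.prob p A \<le> C * measure_pmf.prob r A"
proof -
  have "infsum (pmf p) A \<le> (\<Sum>\<^sub>\<infinity>x\<in>A. C * pmf r x)"
    using assms
    by (intro infsum_mono summable_on_cmult_right pmf_summable_on) (simp add: dominated_def)
  then show ?thesis
    by (simp add: prob_eq_infsum infsum_cmult_right pmf_summable_on)
qed

lemma dominated_ge_1: "dominated C p r \<Longrightarrow> 1 \<le> C"
  using dominated_prob_le[of C p r UNIV] by simp

lemma dominated_mono:
  assumes "dominated C p r" "C \<le> D"
  shows "dominated D p r"
  using assms by (auto simp: dominated_def intro: order_trans[OF _ mult_right_mono])

lemma dominated_trans: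
  assumes "dominated C p q" "dominated D q r"
  shows "dominated (C * D) p r"
  unfolding dominated_def
proof
  fix x
  have "pmf p x \<le> C * pmf q x" using assms(1) by (simp add: dominated_def)
  also have "\<dots> \<le> C * (D * pmf r x)"
    using assms(2) dominated_ge_1[OF assms(1)] by (intro mult_left_mono) (auto simp: dominated_def)
  finally show "pmf p x \<le> C * D * pmf r x" by simp
qed

lemma dominated_bind:
  assumes source: "dominated C p r"
    and kernel: "\<And>x. x \<in> set_pmf p \<Longrightarrow> dominated D (g x) (h x)"
  shows "dominated (C * D) (bind_pmf p g) (bind_pmf r h)"
  unfolding dominated_def
proof
  fix y
  obtain x0 where "x0 \<in> set_pmf p" using set_pmf_not_empty by fast
  then have nonneg: "0 \<le> C * D"
    using dominated_ge_1[OF source] dominated_ge_1[OF kernel] by fastforce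
  have pointwise: "pmf p x * pmf (g x) y \<le> C * D * (pmf r x * pmf (h x) y)" for x
  proof (cases "x \<in> set_pmf p")
    case True
    then have "pmf p x * pmf (g x) y \<le> (C * pmf r x) * (D * pmf (h x) y)"
      using source kernel dominated_ge_1[OF source]
      by (intro mult_mono) (auto simp: dominated_def)
    then show ?thesis by (simp add: algebra_simps)
  qed (use nonneg in \<open>simp add: set_pmf_iff\<close>)
  have "ennreal (pmf (bind_pmf p g) y) =
      (\<integral>\<^sup>+x. ennreal (pmf p x * pmf (g x) y) \<partial>count_space UNIV)"
    by (simp add: ennreal_pmf_bind nn_integral_measure_pmf ennreal_mult)
  also have "\<dots> \<le> (\<integral>\<^sup>+x. ennreal (C * D) * ennreal (pmf r x * pmf (h x) y) \<partial>count_space UNIV)"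
    using nonneg pointwise by (intro nn_integral_mono) (simp add: ennreal_leI flip: ennreal_mult)
  also have "\<dots> = ennreal (C * D * pmf (bind_pmf r h) y)"
    using nonneg
    by (simp add: nn_integral_cmult ennreal_mult ennreal_pmf_bind nn_integral_measure_pmf)
  finally show "pmf (bind_pmf p g) y \<le> C * D * pmf (bind_pmf r h) y"
    using nonneg by simp
qed

lemma dominated_map:
  assumes "dominated C p r"
  shows "dominated C (map_pmf f p) (map_pmf f r)"
  using dominated_bind[OF assms dominated_refl, of "\<lambda>x. return_pmf (f x)"]
  by (simp add: map_pmf_def)

lemma dominated_pair:
  assumes "dominated C p r" "dominated D p' r'"
  shows "dominated (C * D) (pair_pmf p p') (pair_pmf r r')"
  using assms dominated_bind[OF assms(1), of D "\<lambda>x. map_pmf (Pair x) p'" "\<lambda>x. map_pmf (Pair x) r'"]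
  by (simp add: pair_pmf_def map_pmf_def dominated_map[unfolded map_pmf_def])

lemma dominated_iid:
  assumes "dominated C p r"
  shows "dominated (C ^ m) (iid_pmf m p) (iid_pmf m r)"
proof (induction m)
  case 0
  show ?case by (simp add: dominated_refl)
next
  case (Suc m)
  then show ?case by (simp add: dominated_bind[OF assms] dominated_map)
qed

lemma sum_prob_disjoint_dominated_le:
  assumes "finite I" "disjoint_family_on A I" "0 \<le> C"
    and dominated: "\<And>i. i \<in> I \<Longrightarrow> dominated C (P i) Q"
  shows "(\<Sum>i\<in>I. measure_pmf.prob (P i) (A i)) \<le> C"
proof -
  have "(\<Sum>i\<in>I. measure_pmf.prob (P i) (A i)) \<le> (\<Sum>i\<in>I. C * measure_pmf.prob Q (A i))"
    by (intro sum_mono dominated_prob_le dominated)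
  also have "\<dots> = C * measure_pmf.prob Q (\<Union>i\<in>I. A i)"
    using assms measure_pmf.finite_measure_finite_Union[of I A Q] by (simp add: sum_distrib_left)
  also have "\<dots> \<le> C" using \<open>0 \<le> C\<close> by (simp add: mult_left_le)
  finally show ?thesis .
qed

lemma card_mult_prob_le_dominated:
  assumes "finite T" "disjoint_family_on (\<lambda>t. f t ` W) T" "0 \<le> C"
    and "\<And>t. t \<in> T \<Longrightarrow> dominated C (map_pmf (f t) P) Q"
  shows "real (card T) * measure_pmf.prob P W \<le> C"
proof -
  have "measure_pmf.prob P W \<le> measure_pmf.prob (map_pmf (f t) P) (f t ` W)" for t
    by (auto intro!: measure_pmf.finite_measure_mono)
  then have "(\<Sum>t\<in>T. measure_pmf.prob P W) \<le>
      (\<Sum>t\<in>T. measure_pmf.prob (map_pmf (f t) P) (f t ` W))"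
    by (intro sum_mono)
  also have "\<dots> \<le> C" by (rule sum_prob_disjoint_dominated_le) fact+
  finally show ?thesis by simp
qed

section \<open>Total variation and learning dominated hypotheses\<close>

lemma abs_pmf_diff_summable_on: "(\<lambda>x. \<bar>pmf p x - pmf q x\<bar>) summable_on A"
proof (rule summable_on_comparison_test)
  show "(\<lambda>x. pmf p x + pmf q x) summable_on A"
    by (intro summable_on_add pmf_summable_on)
qed (auto simp: abs_if)

lemma dTV_commute: "dTV p q = dTV q p"
  unfolding dTV_def by (simp add: abs_minus_commute)

lemma dTV_triangle: "dTV p r \<le> dTV p q + dTV q r"
proof -
  have "(\<Sum>\<^sub>\<infinity>x. \<bar>pmf p x - pmf r x\<bar>) \<le> (\<Sum>\<^sub>\<infinity>x. \<bar>pmf p x - pmf q x\<bar> + \<bar>pmf q x - pmf r x\<bar>)"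
    by (intro infsum_mono summable_on_add abs_pmf_diff_summable_on) auto
  also have "\<dots> = (\<Sum>\<^sub>\<infinity>x. \<bar>pmf p x - pmf q x\<bar>) + (\<Sum>\<^sub>\<infinity>x. \<bar>pmf q x - pmf r x\<bar>)"
    by (intro infsum_add abs_pmf_diff_summable_on)
  finally show ?thesis unfolding dTV_def by simp
qed

lemma prob_diff_le_infsum:
  "measure_pmf.prob p A - measure_pmf.prob q A \<le> (\<Sum>\<^sub>\<infinity>x\<in>A. \<bar>pmf p x - pmf q x\<bar>)"
proof -
  have "measure_pmf.prob p A \<le> (\<Sum>\<^sub>\<infinity>x\<in>A. pmf q x + \<bar>pmf p x - pmf q x\<bar>)"
    unfolding prob_eq_infsum
    by (intro infsum_mono summable_on_add pmf_summable_on abs_pmf_diff_summable_on) auto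
  also have "\<dots> = measure_pmf.prob q A + (\<Sum>\<^sub>\<infinity>x\<in>A. \<bar>pmf p x - pmf q x\<bar>)"
    unfolding prob_eq_infsum by (intro infsum_add pmf_summable_on abs_pmf_diff_summable_on)
  finally show ?thesis by simp
qed

lemma prob_diff_le_dTV: "measure_pmf.prob p A - measure_pmf.prob q A \<le> dTV p q"
proof -
  have "2 * (measure_pmf.prob p A - measure_pmf.prob q A) =
      (measure_pmf.prob p A - measure_pmf.prob q A) +
      (measure_pmf.prob q (- A) - measure_pmf.prob p (- A))"
    using measure_pmf.prob_compl[of A p] measure_pmf.prob_compl[of A q]
    by (simp add: Compl_eq_Diff_UNIV)
  also have "\<dots> \<le> (\<Sum>\<^sub>\<infinity>x\<in>A. \<bar>pmf p x - pmf q x\<bar>) + (\<Sum>\<^sub>\<infinity>x\<in>- A. \<bar>pmf q x - pmf p x\<bar>)"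
    by (intro add_mono prob_diff_le_infsum)
  also have "\<dots> = (\<Sum>\<^sub>\<infinity>x\<in>A \<union> - A. \<bar>pmf p x - pmf q x\<bar>)"
    by (subst infsum_Un_disjoint) (auto simp: abs_pmf_diff_summable_on abs_minus_commute)
  finally show ?thesis unfolding dTV_def by simp
qed

lemma disjoint_dTV_balls:
  assumes "\<And>i j. i \<in> I \<Longrightarrow> j \<in> I \<Longrightarrow> i \<noteq> j \<Longrightarrow> 2 * eps < dTV (S i) (S j)"
  shows "disjoint_family_on (\<lambda>i. {H. dTV H (S i) \<le> eps}) I"
  unfolding disjoint_family_on_def
proof (intro ballI impI)
  fix i j assume distinct: "i \<in> I" "j \<in> I" "i \<noteq> j"
  have False if "dTV H (S i) \<le> eps" "dTV H (S j) \<le> eps" for H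
    using assms[OF distinct] dTV_triangle[of "S i" "S j" H] dTV_commute[of "S i" H] that by linarith
  then show "{H. dTV H (S i) \<le> eps} \<inter> {H. dTV H (S j) \<le> eps} = {}" by blast
qed

lemma learning_dominated_hypotheses_bound:
  fixes S :: "'i \<Rightarrow> int pmf" and alg :: "int list \<Rightarrow> int pmf pmf"
  assumes "finite I" "0 \<le> C"
    and dominated: "\<And>i. i \<in> I \<Longrightarrow> dominated C (S i) R"
    and far: "\<And>i j. i \<in> I \<Longrightarrow> j \<in> I \<Longrightarrow> i \<noteq> j \<Longrightarrow> 2 * eps < dTV (S i) (S j)"
    and success: "\<And>i. i \<in> I \<Longrightarrow>
      \<delta> \<le> measure_pmf.prob (bind_pmf (iid_pmf m (S i)) alg) {H. dTV H (S i) \<le> eps}"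
  shows "\<delta> * card I \<le> C ^ m"
proof -
  have "\<delta> * card I = (\<Sum>i\<in>I. \<delta>)" by simp
  also have "\<dots> \<le>
      (\<Sum>i\<in>I. measure_pmf.prob (bind_pmf (iid_pmf m (S i)) alg) {H. dTV H (S i) \<le> eps})"
    by (intro sum_mono success)
  also have "\<dots> \<le> C ^ m"
  proof (rule sum_prob_disjoint_dominated_le)
    show "disjoint_family_on (\<lambda>i. {H. dTV H (S i) \<le> eps}) I" by (rule disjoint_dTV_balls[OF far])
    show "dominated (C ^ m) (bind_pmf (iid_pmf m (S i)) alg) (bind_pmf (iid_pmf m R) alg)"
      if "i \<in> I" for i
      using dominated_bind[OF dominated_iid[OF dominated[OF that]] dominated_refl] by simp
  qed (use assms in auto)
  finally show ?thesis .
qed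

section \<open>Distributions that are smooth at a given scale\<close>

lemma pmf_map_plus: "pmf (map_pmf ((+) t) P) (y :: 'a :: ab_group_add) = pmf P (y - t)"
  using pmf_map_inj'[of "(+) t" P "y - t"] by (simp add: inj_def)

definition smooth_at_scale :: "int \<Rightarrow> real \<Rightarrow> int pmf \<Rightarrow> bool" where
  "smooth_at_scale l C P \<longleftrightarrow> (\<exists>Q. \<forall>t\<in>{0..<l}. dominated C (map_pmf ((+) t) P) Q)"

definition unimodal_at :: "int \<Rightarrow> int pmf \<Rightarrow> bool" where
  "unimodal_at c P \<longleftrightarrow> mono_on {..c} (pmf P) \<and> antimono_on {c..} (pmf P)"

lemma unimodal_at_le_mode: "unimodal_at c P \<Longrightarrow> pmf P x \<le> pmf P c"
  by (cases "x \<le> c") (auto simp: unimodal_at_def monotone_on_def)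

text \<open>Up to its mode \<open>P\<close> dominates its translates, and its last translate does so from
  \<open>c + l - 1\<close> on; in between, the uniform distribution does.\<close>
lemma unimodal_at_smooth_at_scale:
  assumes unimodal: "unimodal_at c P" and mode: "pmf P c \<le> 1 / l" and "0 < l"
  shows "smooth_at_scale l 3 P"
proof -
  define last_translate where "last_translate = map_pmf ((+) (l - 1)) P"
  define uniform where "uniform = pmf_of_set {c..<c + l}"
  define Q where "Q = bind_pmf (pmf_of_set {0, 1, 2}) ((!) [P, last_translate, uniform])"
  have mixture: "3 * pmf Q y = pmf P y + pmf P (y - (l - 1)) + pmf uniform y" for y
    by (simp add: Q_def pmf_bind_pmf_of_set last_translate_def pmf_map_plus eval_nat_numeral)
  have uniform: "pmf uniform y = 1 / l" if "c \<le> y" "y < c + l" for y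
    using that \<open>0 < l\<close> by (simp add: uniform_def)
  have "pmf P (y - t) \<le> 3 * pmf Q y" if "t \<in> {0..<l}" for t y
  proof -
    consider (before_mode) "y \<le> c" | (after_mode) "c \<le> y - (l - 1)"
      | (near_mode) "c \<le> y" "y < c + l" by linarith
    then have "pmf P (y - t) \<le> pmf P y \<or> pmf P (y - t) \<le> pmf P (y - (l - 1)) \<or>
        pmf P (y - t) \<le> pmf uniform y"
    proof cases
      case before_mode
      then show ?thesis using unimodal that by (auto simp: unimodal_at_def monotone_on_def)
    next
      case after_mode
      then show ?thesis using unimodal that by (auto simp: unimodal_at_def monotone_on_def)
    next
      case near_mode
      then show ?thesis using unimodal_at_le_mode[OF unimodal, of "y - t"] mode uniform by force
    qed
    then show ?thesis
      unfolding mixture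
      using pmf_nonneg[of P y] pmf_nonneg[of P "y - (l - 1)"] pmf_nonneg[of uniform y] by linarith
  qed
  then show ?thesis
    unfolding smooth_at_scale_def dominated_def pmf_map_plus by blast
qed

definition separated :: "int \<Rightarrow> int set \<Rightarrow> bool" where
  "separated l Z \<longleftrightarrow> pairwise (\<lambda>x y. l \<le> \<bar>x - y\<bar>) Z"

lemma separated_translate: "separated l Z \<Longrightarrow> separated l ((+) t ` Z)"
  unfolding separated_def pairwise_image by (auto simp: pairwise_def)

lemma prob_separated_le:
  assumes smooth: "smooth_at_scale l C P" and separated: "separated l Z" and "0 < l"
  shows "measure_pmf.prob P Z \<le> C / l"
proof -
  obtain Q where dominated: "\<And>t. t \<in> {0..<l} \<Longrightarrow> dominated C (map_pmf ((+) t) P) Q"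
    using smooth unfolding smooth_at_scale_def by blast
  have "real (card {0..<l}) * measure_pmf.prob P Z \<le> C"
  proof (rule card_mult_prob_le_dominated[OF _ _ _ dominated])
    show "disjoint_family_on (\<lambda>t. (+) t ` Z) {0..<l}"
      using separated by (fastforce simp: disjoint_family_on_def separated_def pairwise_def)
    show "0 \<le> C" using dominated_ge_1[OF dominated[of 0]] \<open>0 < l\<close> by simp
  qed auto
  then show ?thesis using \<open>0 < l\<close> by (simp add: field_simps)
qed

lemma prob_separated_windows_le:
  assumes smooth: "smooth_at_scale l C P" and separated: "separated l Z" and "0 < l" "0 \<le> w"
  shows "measure_pmf.prob P (\<Union>t\<in>{0..<w}. (+) t ` Z) \<le> w * (C / l)"
proof -
  have "measure_pmf.prob P (\<Union>t\<in>{0..<w}. (+) t ` Z) \<le>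
      (\<Sum>t\<in>{0..<w}. measure_pmf.prob P ((+) t ` Z))"
    by (rule measure_UNION_le) auto
  also have "\<dots> \<le> (\<Sum>t\<in>{0..<w}. C / l)"
    by (intro sum_mono prob_separated_le smooth separated_translate separated \<open>0 < l\<close>)
  also have "\<dots> = w * (C / l)" using \<open>0 \<le> w\<close> by simp
  finally show ?thesis .
qed

lemma prob_pair_box_separated_le:
  assumes smooth: "smooth_at_scale l C P" "smooth_at_scale l' C' P'"
    and separated: "pairwise (\<lambda>(u, v) (u', v'). l \<le> \<bar>u - u'\<bar> \<or> l' \<le> \<bar>v - v'\<bar>) D"
    and pos: "0 < l" "0 < l'"
  shows "measure_pmf.prob (pair_pmf P P') D \<le> C * C' / (l * l')"
proof -
  let ?shift = "\<lambda>(t, t') (u, v). (t + u, t' + v)"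
  obtain Q Q' where dominated: "\<And>t. t \<in> {0..<l} \<Longrightarrow> dominated C (map_pmf ((+) t) P) Q"
      "\<And>t. t \<in> {0..<l'} \<Longrightarrow> dominated C' (map_pmf ((+) t) P') Q'"
    using smooth unfolding smooth_at_scale_def by blast
  have "1 \<le> C" "1 \<le> C'"
    using dominated_ge_1[OF dominated(1)[of 0]] dominated_ge_1[OF dominated(2)[of 0]] pos by auto
  have "real (card ({0..<l} \<times> {0..<l'})) * measure_pmf.prob (pair_pmf P P') D \<le> C * C'"
  proof (rule card_mult_prob_le_dominated)
    show "disjoint_family_on (\<lambda>t. ?shift t ` D) ({0..<l} \<times> {0..<l'})"
      using separated by (fastforce simp: disjoint_family_on_def pairwise_def)
    show "dominated (C * C') (map_pmf (?shift t) (pair_pmf P P')) (pair_pmf Q Q')"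
      if "t \<in> {0..<l} \<times> {0..<l'}" for t
      using that by (auto simp: map_pair intro!: dominated_pair dominated)
  qed (use \<open>1 \<le> C\<close> \<open>1 \<le> C'\<close> in auto)
  then show ?thesis using pos by (simp add: field_simps)
qed

section \<open>Fair binomials\<close>

definition fair_binomial :: "nat \<Rightarrow> int pmf" where
  "fair_binomial n = map_pmf int (binomial_pmf (2 * n) (1/2))"

lemma set_pmf_fair_binomial: "set_pmf (fair_binomial n) = {0..2 * int n}"
  by (simp add: fair_binomial_def atMost_atLeast0 image_int_atLeastAtMost)

lemma pmf_fair_binomial:
  "pmf (fair_binomial n) x = (if x < 0 then 0 else real ((2 * n) choose nat x) / 4 ^ n)"
proof (cases "x < 0")
  case True
  then show ?thesis by (simp add: pmf_eq_0_set_pmf set_pmf_fair_binomial)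
next
  case False
  then obtain k where "x = int k" by (metis not_less zero_le_imp_eq_int)
  have "pmf (fair_binomial n) (int k) = pmf (binomial_pmf (2 * n) (1/2)) k"
    unfolding fair_binomial_def by (rule pmf_map_inj') simp
  also have "\<dots> = real ((2 * n) choose k) * ((1/2) ^ k * (1/2) ^ (2 * n - k))" by simp
  also have "\<dots> = real ((2 * n) choose k) / 4 ^ n"
  proof (cases "k \<le> 2 * n")
    case True
    then have "(1/2 :: real) ^ k * (1/2) ^ (2 * n - k) = (1/2) ^ (2 * n)"
      by (simp flip: power_add)
    then show ?thesis by (simp add: power_mult power_divide power2_eq_square)
  qed (simp add: binomial_eq_0)
  finally show ?thesis using \<open>x = int k\<close> by simp
qed

lemma unimodal_at_fair_binomial: "unimodal_at (int n) (fair_binomial n)"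
  unfolding unimodal_at_def
proof
  show "mono_on {..int n} (pmf (fair_binomial n))"
    by (auto simp: monotone_on_def pmf_fair_binomial intro!: divide_right_mono binomial_mono)
  have "pmf (fair_binomial n) y \<le> pmf (fair_binomial n) x" if "int n \<le> x" "x \<le> y" for x y
  proof (cases "y \<le> 2 * int n")
    case True
    then show ?thesis
      using that by (auto simp: pmf_fair_binomial intro!: divide_right_mono binomial_antimono)
  next
    case False
    then show ?thesis by (simp add: pmf_eq_0_set_pmf[THEN iffD2] set_pmf_fair_binomial)
  qed
  then show "antimono_on {int n..} (pmf (fair_binomial n))" by (simp add: monotone_on_def)
qed

lemma central_binomial_Suc:
  "Suc n * ((2 * Suc n) choose Suc n) = 2 * (2 * n + 1) * ((2 * n) choose n)"
proof -
  have "Suc n * ((2 * Suc n) choose Suc n) = (2 * Suc n) * ((2 * n + 1) choose n)"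
    using binomial_absorption[of n "2 * Suc n"] by (simp del: binomial_Suc_Suc)
  moreover have "Suc n * ((2 * n + 1) choose n) = (2 * n + 1) * ((2 * n) choose n)"
    using binomial_absorption[of n "2 * n + 1"] binomial_symmetric[of n "2 * n + 1"]
    by (simp del: binomial_Suc_Suc)
  ultimately show ?thesis by (simp del: binomial_Suc_Suc)
qed

lemma central_binomial_upper_bound:
  "(real ((2 * n) choose n))\<^sup>2 * (2 * real n + 1) \<le> 16 ^ n"
proof (induction n)
  case (Suc n)
  have "(real n + 1) * real ((2 * Suc n) choose Suc n) =
      2 * (2 * real n + 1) * real ((2 * n) choose n)"
    using arg_cong[OF central_binomial_Suc[of n], of real]
    by (simp del: binomial_Suc_Suc add: algebra_simps)
  then have Suc_eq: "real ((2 * Suc n) choose Suc n) =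
      2 * (2 * real n + 1) * real ((2 * n) choose n) / (real n + 1)"
    by (simp add: field_simps del: binomial_Suc_Suc)
  have "(real ((2 * Suc n) choose Suc n))\<^sup>2 * (2 * real (Suc n) + 1) =
      ((real ((2 * n) choose n))\<^sup>2 * (2 * real n + 1)) *
      (4 * ((2 * real n + 1) * (2 * real n + 3)) / (real n + 1)\<^sup>2)"
    unfolding Suc_eq by (simp add: power2_eq_square field_simps del: binomial_Suc_Suc)
  also have "\<dots> \<le> 16 ^ n * 16"
  proof (rule mult_mono[OF Suc.IH])
    have "4 * ((2 * real n + 1) * (2 * real n + 3)) \<le> 16 * (real n + 1)\<^sup>2"
      by (simp add: power2_eq_square algebra_simps)
    then show "4 * ((2 * real n + 1) * (2 * real n + 3)) / (real n + 1)\<^sup>2 \<le> 16"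
      by (simp add: divide_le_eq)
  qed auto
  finally show ?case by simp
qed simp

lemma pmf_fair_binomial_mode_le:
  assumes "0 < n"
  shows "pmf (fair_binomial n) (int n) \<le> 1 / sqrt n"
proof -
  let ?c = "real ((2 * n) choose n)"
  have "(?c * sqrt n)\<^sup>2 \<le> ?c\<^sup>2 * (2 * real n + 1)"
    by (simp add: power_mult_distrib mult_left_mono)
  also have "\<dots> \<le> 16 ^ n" by (rule central_binomial_upper_bound)
  also have "\<dots> = (4 ^ n)\<^sup>2" by (simp add: power2_eq_square flip: power_mult_distrib)
  finally have "?c * sqrt n \<le> 4 ^ n" by (rule power2_le_imp_le) simp
  then show ?thesis using assms by (simp add: pmf_fair_binomial field_simps)
qed

lemma smooth_at_scale_fair_binomial:
  assumes "0 < l" "l\<^sup>2 \<le> int n"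
  shows "smooth_at_scale l 3 (fair_binomial n)"
proof (rule unimodal_at_smooth_at_scale[OF unimodal_at_fair_binomial])
  have "0 < l\<^sup>2" using assms by simp
  then have "0 < n" using assms by linarith
  have "(real_of_int l)\<^sup>2 \<le> real n"
    using assms(2) by (metis of_int_le_iff of_int_of_nat_eq of_int_power)
  then have "real_of_int l \<le> sqrt n" by (rule real_le_rsqrt)
  then have "1 / sqrt n \<le> 1 / l" using assms by (simp add: frac_le)
  with pmf_fair_binomial_mode_le[OF \<open>0 < n\<close>]
  show "pmf (fair_binomial n) (int n) \<le> 1 / l" by simp
qed fact

lemma fair_binomial_concentration:
  assumes "0 < n" "0 \<le> t"
  shows "1 - 2 * exp (- (t\<^sup>2 / n)) \<le>
    measure_pmf.prob (fair_binomial n) {x. \<bar>real_of_int x - n\<bar> < t}"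
proof -
  let ?B = "binomial_pmf (2 * n) (1/2)" and ?tail = "{x. t \<le> \<bar>real x - real (2 * n) * (1/2)\<bar>}"
  interpret binomial_distribution "2 * n" "1/2" by unfold_locales auto
  have "measure_pmf.prob ?B ?tail \<le> 2 * exp (-2 * t\<^sup>2 / real (2 * n))"
    using prob_abs_ge[of t] assms by simp
  also have "-2 * t\<^sup>2 / real (2 * n) = - (t\<^sup>2 / n)" by simp
  finally have "1 - 2 * exp (- (t\<^sup>2 / n)) \<le> measure_pmf.prob ?B (- ?tail)"
    using measure_pmf.prob_compl[of ?tail ?B] by (simp add: Compl_eq_Diff_UNIV)
  also have "- ?tail = int -` {x. \<bar>real_of_int x - n\<bar> < t}" by auto
  finally show ?thesis by (simp add: fair_binomial_def)
qed

lemma fair_binomial_within_two_sqrt: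
  assumes "0 < L"
  shows "7 / 8 \<le> measure_pmf.prob (fair_binomial (L\<^sup>2)) {x. \<bar>x - int (L\<^sup>2)\<bar> \<le> 2 * int L}"
proof -
  have "2 ^ 4 \<le> exp (1 :: real) ^ 4" using exp_ge_add_one_self[of 1] by (intro power_mono) auto
  then have "16 \<le> exp (4 :: real)" by (simp flip: exp_of_nat_mult)
  moreover have "(2 * real L)\<^sup>2 / real (L\<^sup>2) = 4" using assms by (simp add: power2_eq_square)
  ultimately have "7 / 8 \<le> 1 - 2 * exp (- ((2 * real L)\<^sup>2 / real (L\<^sup>2)))"
    by (simp add: exp_minus field_simps)
  also have "\<dots> \<le>
      measure_pmf.prob (fair_binomial (L\<^sup>2)) {x. \<bar>real_of_int x - real (L\<^sup>2)\<bar> < 2 * real L}"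
    using assms by (intro fair_binomial_concentration) auto
  also have "\<dots> \<le> measure_pmf.prob (fair_binomial (L\<^sup>2)) {x. \<bar>x - int (L\<^sup>2)\<bar> \<le> 2 * int L}"
  proof (intro measure_pmf.finite_measure_mono subsetI)
    fix x assume "x \<in> {x. \<bar>real_of_int x - real (L\<^sup>2)\<bar> < 2 * real L}"
    then have "real_of_int \<bar>x - int (L\<^sup>2)\<bar> < real_of_int (2 * int L)" by simp
    then show "x \<in> {x. \<bar>x - int (L\<^sup>2)\<bar> \<le> 2 * int L}" unfolding of_int_less_iff by simp
  qed simp
  finally show ?thesis .
qed

section \<open>Lattices without short vectors\<close>

definition no_short_vectors :: "int \<Rightarrow> int \<Rightarrow> int \<Rightarrow> int \<Rightarrow> bool" where
  "no_short_vectors p q l l' \<longleftrightarrow>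
    (\<forall>u v. q dvd u + p * v \<longrightarrow> \<bar>u\<bar> < l \<longrightarrow> \<bar>v\<bar> < l' \<longrightarrow> u = 0 \<and> v = 0)"

lemma no_short_vectorsD:
  assumes "no_short_vectors p q l l'" "q dvd u + p * v" "\<bar>u\<bar> < l" "\<bar>v\<bar> < l'"
  shows "u = 0" "v = 0"
  using assms by (auto simp: no_short_vectors_def)

lemma no_short_vectors_antimono:
  "no_short_vectors p q l l' \<Longrightarrow> k \<le> l \<Longrightarrow> k' \<le> l' \<Longrightarrow> no_short_vectors p q k k'"
  unfolding no_short_vectors_def by (meson less_le_trans)

fun fib_poly :: "nat \<Rightarrow> nat \<Rightarrow> nat" where
  "fib_poly a 0 = 0"
| "fib_poly a (Suc 0) = 1"
| "fib_poly a (Suc (Suc n)) = a * fib_poly a (Suc n) + fib_poly a n"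

lemma mult_fib_poly_le_Suc: "a * fib_poly a n \<le> fib_poly a (Suc n)"
  by (cases n) auto

lemma fib_poly_pos: "0 < a \<Longrightarrow> 0 < n \<Longrightarrow> 0 < fib_poly a n"
  by (induction a n rule: fib_poly.induct) auto

lemma strict_mono_fib_poly:
  assumes "1 < a"
  shows "strict_mono (fib_poly a)"
proof (rule strict_mono_Suc_iff[THEN iffD2], rule allI)
  fix n
  show "fib_poly a n < fib_poly a (Suc n)"
  proof (cases "n = 0")
    case False
    then have "fib_poly a n < a * fib_poly a n" using assms fib_poly_pos[of a n] by simp
    then show ?thesis using mult_fib_poly_le_Suc[of a n] by linarith
  qed simp
qed

lemma fib_poly_increasing:
  assumes "1 < a" "1 < n"
  shows "1 < fib_poly a n" "fib_poly a n < fib_poly a (Suc n)"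
  using assms strict_monoD[OF strict_mono_fib_poly, of a 1 n]
    strict_monoD[OF strict_mono_fib_poly, of a n "Suc n"] by simp_all

lemma fib_poly_Suc_le:
  assumes "0 < a" "0 < n"
  shows "fib_poly a (Suc n) \<le> (a + 1) * fib_poly a n"
proof -
  obtain m where n_eq: "n = Suc m" using assms by (cases n) auto
  have "fib_poly a m \<le> a * fib_poly a m" using assms by simp
  also have "\<dots> \<le> fib_poly a n" unfolding n_eq by (rule mult_fib_poly_le_Suc)
  finally show ?thesis unfolding n_eq by simp
qed

lemma fib_poly_Suc_le_power: "0 < a \<Longrightarrow> fib_poly a (Suc n) \<le> (a + 1) ^ n"
proof (induction n)
  case (Suc n)
  then show ?case
    using order_trans[OF fib_poly_Suc_le[of a "Suc n"] mult_left_mono] by simp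
qed simp

lemma fib_poly_add:
  "fib_poly a (m + Suc k) = fib_poly a (Suc m) * fib_poly a (Suc k) + fib_poly a m * fib_poly a k"
proof (induction k arbitrary: m)
  case (Suc k)
  then show ?case using Suc.IH[of "Suc m"] by (simp add: algebra_simps)
qed simp

lemma fib_poly_Suc_le_mult:
  assumes "0 < a" "0 < k" "k < n"
  shows "fib_poly a (Suc n) \<le> ((a + 1)\<^sup>2 + 1) * (fib_poly a (n - k) * fib_poly a k)"
proof -
  have "fib_poly a (Suc n) =
      fib_poly a (Suc (n - k)) * fib_poly a (Suc k) + fib_poly a (n - k) * fib_poly a k"
    using fib_poly_add[of a "n - k" k] assms by simp
  also have "fib_poly a (Suc (n - k)) * fib_poly a (Suc k) \<le>
      ((a + 1) * fib_poly a (n - k)) * ((a + 1) * fib_poly a k)"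
    using assms by (intro mult_le_mono fib_poly_Suc_le) auto
  finally show ?thesis by (simp add: power2_eq_square algebra_simps)
qed

lemma fib_poly_d_Ocagne:
  "int (fib_poly a (k + j)) * fib_poly a (Suc k) =
    int (fib_poly a (Suc (k + j))) * fib_poly a k + (-1) ^ k * fib_poly a j"
proof (induction k)
  case (Suc k)
  then show ?case by (simp add: algebra_simps)
qed simp

lemma fib_poly_Suc_dvd:
  assumes "k \<le> Suc n"
  shows "int (fib_poly a (Suc n)) dvd
    int (fib_poly a n) * fib_poly a k + (-1) ^ k * fib_poly a (Suc n - k)"
proof (cases k)
  case (Suc i)
  then have "n = i + (n - i)" using assms by simp
  then show ?thesis using fib_poly_d_Ocagne[of a i "n - i"] Suc by simp
qed simp

text \<open>Cramer's rule in the lattice basis \<open>(c, a)\<close>, \<open>(- d, b)\<close> of determinant \<open>q\<close>.\<close>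
lemma integer_coordinates:
  fixes a b c d q v w :: int
  assumes det: "q = c * b + d * a" and "q \<noteq> 0"
    and dvd: "q dvd b * w + d * v" "q dvd c * v - a * w"
  obtains \<alpha> \<beta> where "w = c * \<alpha> - d * \<beta>" "v = a * \<alpha> + b * \<beta>"
proof -
  obtain \<alpha> \<beta> where quotients: "b * w + d * v = q * \<alpha>" "c * v - a * w = q * \<beta>"
    using dvd by (auto elim!: dvdE)
  have "q * w = c * (b * w + d * v) - d * (c * v - a * w)"
    by (simp add: det algebra_simps)
  then have "q * w = q * (c * \<alpha> - d * \<beta>)" unfolding quotients by (simp add: algebra_simps)
  moreover have "q * v = a * (b * w + d * v) + b * (c * v - a * w)"
    by (simp add: det algebra_simps)
  then have "q * v = q * (a * \<alpha> + b * \<beta>)" unfolding quotients by (simp add: algebra_simps)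
  ultimately show ?thesis using that \<open>q \<noteq> 0\<close> by simp
qed

lemma coordinates_eq_0_if_short:
  fixes a b c d \<alpha> \<beta> :: int
  assumes nonneg: "0 \<le> a" "0 \<le> b" "0 \<le> c" "0 \<le> d"
    and short: "\<bar>c * \<alpha> - d * \<beta>\<bar> < c" "\<bar>a * \<alpha> + b * \<beta>\<bar> < b"
  shows "\<alpha> = 0 \<and> \<beta> = 0"
proof -
  have abs_mult_ge: "x \<le> x * \<bar>y\<bar>" if "0 \<le> x" "y \<noteq> 0" for x y :: int
    using that by (auto simp: mult_le_cancel_left1)
  have abs_same_sign: "\<bar>x * \<gamma> + y * \<delta>\<bar> = x * \<bar>\<gamma>\<bar> + y * \<bar>\<delta>\<bar>"
    if "0 \<le> \<gamma> * \<delta>" "0 \<le> x" "0 \<le> y" for x y \<gamma> \<delta> :: int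
    using that by (auto simp: zero_le_mult_iff mult_nonneg_nonpos add_nonpos_nonpos)
  show ?thesis
  proof (cases "0 \<le> \<alpha> * \<beta>")
    case True
    then have "\<bar>a * \<alpha> + b * \<beta>\<bar> = a * \<bar>\<alpha>\<bar> + b * \<bar>\<beta>\<bar>"
      using nonneg by (intro abs_same_sign)
    moreover have "0 \<le> a * \<bar>\<alpha>\<bar>" using nonneg by simp
    ultimately have "\<beta> = 0" using short nonneg abs_mult_ge[of b \<beta>] by (smt (verit))
    moreover from this have "\<alpha> = 0" using short abs_mult_ge[of c \<alpha>] nonneg by (auto simp: abs_mult)
    ultimately show ?thesis by simp
  next
    case False
    then have "\<bar>c * \<alpha> - d * \<beta>\<bar> = c * \<bar>\<alpha>\<bar> + d * \<bar>\<beta>\<bar>"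
      using nonneg abs_same_sign[of \<alpha> "- \<beta>" c d] by simp
    moreover have "\<alpha> \<noteq> 0" using False by auto
    then have "c \<le> c * \<bar>\<alpha>\<bar>" using nonneg by (intro abs_mult_ge)
    moreover have "0 \<le> d * \<bar>\<beta>\<bar>" using nonneg by simp
    ultimately show ?thesis using short by linarith
  qed
qed

text \<open>The coordinates of \<open>(u, v)\<close> in the lattice basis \<open>((-1) ^ i * F (n + 1 - i), F i)\<close>,
  \<open>i = k, k + 1\<close>.\<close>
lemma fib_poly_lattice_coordinates:
  assumes a_pos: "0 < a" and k_le: "k \<le> n"
    and lattice: "int (fib_poly a (Suc n)) dvd u + int (fib_poly a n) * v"
  obtains \<alpha> \<beta> where
    "(-1) ^ k * u = int (fib_poly a (Suc n - k)) * \<alpha> - int (fib_poly a (n - k)) * \<beta>"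
    "v = int (fib_poly a k) * \<alpha> + int (fib_poly a (Suc k)) * \<beta>"
proof -
  define F :: "nat \<Rightarrow> int" where "F i = int (fib_poly a i)" for i
  have lattice: "F (Suc n) dvd u + F n * v" using lattice by (simp add: F_def)
  have sign: "(-1) ^ k * ((-1) ^ k * x) = x" for x :: int
    by (simp flip: mult.assoc power_mult_distrib)
  have basis: "F (Suc n) dvd F n * F k + (-1) ^ k * F (Suc n - k)"
      "F (Suc n) dvd F n * F (Suc k) - (-1) ^ k * F (n - k)"
    using fib_poly_Suc_dvd[of k n a] fib_poly_Suc_dvd[of "Suc k" n a] k_le
    by (auto simp: F_def)
  have "F (Suc n) = F (Suc n - k) * F (Suc k) + F (n - k) * F k"
    using fib_poly_add[of a "n - k" k] k_le by (simp add: F_def Suc_diff_le)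
  moreover have "F (Suc n) \<noteq> 0" using fib_poly_pos[OF a_pos, of "Suc n"] by (simp add: F_def)
  moreover have "F (Suc n) dvd (-1) ^ k *
      (F (Suc k) * (u + F n * v) - v * (F n * F (Suc k) - (-1) ^ k * F (n - k)))"
    by (intro dvd_mult dvd_diff lattice basis)
  then have "F (Suc n) dvd F (Suc k) * ((-1) ^ k * u) + F (n - k) * v"
    by (simp add: algebra_simps sign)
  moreover have "F (Suc n) dvd (-1) ^ k *
      (v * (F n * F k + (-1) ^ k * F (Suc n - k)) - F k * (u + F n * v))"
    by (intro dvd_mult dvd_diff lattice basis)
  then have "F (Suc n) dvd F (Suc n - k) * v - F k * ((-1) ^ k * u)"
    by (simp add: algebra_simps sign)
  ultimately show thesis
    by (rule integer_coordinates) (rule that[folded F_def])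
qed

lemma no_short_vectors_fib_poly:
  assumes "0 < a" "k \<le> n"
  shows "no_short_vectors (fib_poly a n) (fib_poly a (Suc n))
    (fib_poly a (Suc n - k)) (fib_poly a (Suc k))"
  unfolding no_short_vectors_def
proof (intro allI impI)
  fix u v
  assume lattice: "int (fib_poly a (Suc n)) dvd u + int (fib_poly a n) * v"
    and short: "\<bar>u\<bar> < int (fib_poly a (Suc n - k))" "\<bar>v\<bar> < int (fib_poly a (Suc k))"
  obtain \<alpha> \<beta> where coordinates:
    "(-1) ^ k * u = int (fib_poly a (Suc n - k)) * \<alpha> - int (fib_poly a (n - k)) * \<beta>"
    "v = int (fib_poly a k) * \<alpha> + int (fib_poly a (Suc k)) * \<beta>"
    by (rule fib_poly_lattice_coordinates[OF assms lattice])
  have "\<bar>(-1) ^ k * u\<bar> < int (fib_poly a (Suc n - k))" using short by (simp add: abs_mult)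
  then have "\<alpha> = 0 \<and> \<beta> = 0"
    using short unfolding coordinates by (intro coordinates_eq_0_if_short) auto
  then show "u = 0 \<and> v = 0" using coordinates by simp
qed

lemma no_short_vectors_fib_poly_diff:
  assumes "1 < a" "k \<le> n"
  shows "no_short_vectors (fib_poly a n) (fib_poly a (Suc n)) (fib_poly a (n - k)) (fib_poly a k)"
  using assms
  by (intro no_short_vectors_antimono[OF no_short_vectors_fib_poly[of a k n]])
    (auto simp: strict_mono_less_eq[OF strict_mono_fib_poly])

section \<open>Sums of independent variables\<close>

definition convolve_pmf :: "int pmf \<Rightarrow> int pmf \<Rightarrow> int pmf" where
  "convolve_pmf S T = map_pmf (\<lambda>(x, y). x + y) (pair_pmf S T)"

lemma convolve_pmf_return_0: "convolve_pmf S (return_pmf 0) = S"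
  by (simp add: convolve_pmf_def pair_return_pmf2 pmf.map_comp o_def)

lemma convolve_pmf_commute: "convolve_pmf S T = convolve_pmf T S"
  unfolding convolve_pmf_def
  by (subst pair_commute_pmf) (simp add: pmf.map_comp o_def case_prod_unfold add.commute)

lemma convolve_pmf_altdef: "convolve_pmf S T = bind_pmf S (\<lambda>x. map_pmf ((+) x) T)"
  by (simp add: convolve_pmf_def pair_pmf_def map_pmf_def bind_assoc_pmf bind_return_pmf)

lemma convolve_pmf_assoc: "convolve_pmf (convolve_pmf R S) T = convolve_pmf R (convolve_pmf S T)"
  by (simp add: convolve_pmf_altdef map_pmf_def bind_assoc_pmf bind_return_pmf add.assoc)

lemma dominated_convolve:
  assumes "dominated C p r" "dominated D p' r'"
  shows "dominated (C * D) (convolve_pmf p p') (convolve_pmf r r')"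
  unfolding convolve_pmf_def by (intro dominated_map dominated_pair assms)

lemma sum_indep_pmf_cong:
  "(\<And>i. i < n \<Longrightarrow> Xs i = Ys i) \<Longrightarrow> sum_indep_pmf Xs n = sum_indep_pmf Ys n"
  by (induction n) auto

lemma sum_indep_pmf_Suc: "sum_indep_pmf Xs (Suc n) = convolve_pmf (sum_indep_pmf Xs n) (Xs n)"
  by (simp add: convolve_pmf_def)

lemma sum_indep_pmf_add:
  "sum_indep_pmf Xs (m + n) =
    convolve_pmf (sum_indep_pmf Xs m) (sum_indep_pmf (\<lambda>i. Xs (m + i)) n)"
proof (induction n)
  case (Suc n)
  then show ?case by (simp add: sum_indep_pmf_Suc convolve_pmf_assoc del: sum_indep_pmf.simps)
qed (simp add: convolve_pmf_return_0)

lemma is_A_sum_convolve: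
  assumes "is_A_sum A m S" "is_A_sum A n T"
  shows "is_A_sum A (m + n) (convolve_pmf S T)"
proof -
  obtain Xs Ys where Xs: "\<And>i. i < m \<Longrightarrow> set_pmf (Xs i) \<subseteq> A" "S = sum_indep_pmf Xs m"
    and Ys: "\<And>i. i < n \<Longrightarrow> set_pmf (Ys i) \<subseteq> A" "T = sum_indep_pmf Ys n"
    using assms unfolding is_A_sum_def by blast
  define Zs where "Zs i = (if i < m then Xs i else Ys (i - m))" for i
  have "sum_indep_pmf Zs m = S" unfolding Xs(2) by (rule sum_indep_pmf_cong) (simp add: Zs_def)
  moreover have "sum_indep_pmf (\<lambda>i. Zs (m + i)) n = T" unfolding Ys(2) by (simp add: Zs_def)
  moreover have "set_pmf (Zs i) \<subseteq> A" if "i < m + n" for i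
    using that Xs(1)[of i] Ys(1)[of "i - m"] by (auto simp: Zs_def)
  ultimately show ?thesis unfolding is_A_sum_def using sum_indep_pmf_add[of Zs m n] by metis
qed

lemma is_A_sum_mono:
  assumes sum: "is_A_sum A m S" and "0 \<in> A" "m \<le> n"
  shows "is_A_sum A n S"
proof -
  have "sum_indep_pmf (\<lambda>_. return_pmf 0) k = return_pmf 0" for k by (induction k) auto
  then have "is_A_sum A (n - m) (return_pmf 0)"
    unfolding is_A_sum_def using \<open>0 \<in> A\<close> by (intro exI[of _ "\<lambda>_. return_pmf 0"]) auto
  from is_A_sum_convolve[OF sum this] show ?thesis
    using \<open>m \<le> n\<close> by (simp add: convolve_pmf_return_0)
qed

lemma is_A_sum_fair_binomial:
  assumes "0 \<in> A" "a \<in> A"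
  shows "is_A_sum A (2 * n) (map_pmf ((*) a) (fair_binomial n))"
proof -
  define coin :: "int pmf" where "coin = map_pmf (\<lambda>b. if b then a else 0) (bernoulli_pmf (1/2))"
  have "sum_indep_pmf (\<lambda>_. coin) k = map_pmf (\<lambda>j. a * int j) (binomial_pmf k (1/2))" for k
  proof (induction k)
    case 0
    show ?case by (simp add: binomial_pmf_0)
  next
    case (Suc k)
    have "sum_indep_pmf (\<lambda>_. coin) (Suc k) =
        convolve_pmf coin (map_pmf (\<lambda>j. a * int j) (binomial_pmf k (1/2)))"
      by (simp only: sum_indep_pmf_Suc Suc.IH convolve_pmf_commute)
    also have "\<dots> = map_pmf (\<lambda>j. a * int j) (binomial_pmf (Suc k) (1/2))"
      by (auto simp: binomial_pmf_Suc coin_def convolve_pmf_altdef pair_pmf_def map_pmf_def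
        bind_assoc_pmf bind_return_pmf algebra_simps intro!: bind_pmf_cong)
    finally show ?case .
  qed
  then have "sum_indep_pmf (\<lambda>_. coin) (2 * n) = map_pmf ((*) a) (fair_binomial n)"
    by (simp add: fair_binomial_def pmf.map_comp o_def)
  moreover have "set_pmf coin \<subseteq> A" using assms by (auto simp: coin_def)
  ultimately show ?thesis unfolding is_A_sum_def by metis
qed

lemma convolve_multiples_dominated:
  fixes W Y Q :: "int pmf"
  assumes "0 < q"
    and residue: "\<And>s. measure_pmf.prob W {w. w mod q = s} \<le> \<kappa> / q"
    and quotient: "\<And>w. w \<in> set_pmf W \<Longrightarrow> w div q \<in> {0..<l}"
    and translate: "\<And>t. t \<in> {0..<l} \<Longrightarrow> dominated C (map_pmf ((+) t) Y) Q"
  shows "dominated (C * \<kappa>) (convolve_pmf W (map_pmf ((*) q) Y))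
    (convolve_pmf (pmf_of_set {0..<q}) (map_pmf ((*) q) Q))"
proof -
  let ?residue = "map_pmf (\<lambda>w. w mod q) W"
  have "dominated (1 * C)
      (bind_pmf W (\<lambda>w. map_pmf (\<lambda>y. w mod q + q * y) (map_pmf ((+) (w div q)) Y)))
      (bind_pmf W (\<lambda>w. map_pmf (\<lambda>y. w mod q + q * y) Q))"
    by (intro dominated_bind dominated_refl dominated_map translate quotient)
  moreover have "w mod q + q * (w div q + y) = w + q * y" for w y
    by (simp add: distrib_left flip: add.assoc)
  ultimately have replace_Y:
    "dominated C (convolve_pmf W (map_pmf ((*) q) Y)) (convolve_pmf ?residue (map_pmf ((*) q) Q))"
    by (simp add: convolve_pmf_altdef bind_map_pmf pmf.map_comp o_def)
  have "pmf ?residue s \<le> \<kappa> * pmf (pmf_of_set {0..<q}) s" for s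
  proof (cases "s \<in> {0..<q}")
    case True
    then show ?thesis using residue[of s] \<open>0 < q\<close> by (simp add: pmf_map vimage_def)
  next
    case False
    then have "s \<notin> set_pmf ?residue" using \<open>0 < q\<close> by auto
    then show ?thesis using False \<open>0 < q\<close> by (simp add: pmf_eq_0_set_pmf[THEN iffD2])
  qed
  then have replace_residue: "dominated (\<kappa> * 1) (convolve_pmf ?residue (map_pmf ((*) q) Q))
      (convolve_pmf (pmf_of_set {0..<q}) (map_pmf ((*) q) Q))"
    by (intro dominated_convolve dominated_refl) (simp add: dominated_def)
  show ?thesis using dominated_trans[OF replace_Y replace_residue] by simp
qed

lemma prob_convolve_multiples_periodic:
  assumes "\<And>x y. x + q * y \<in> E \<longleftrightarrow> x \<in> E"
  shows "measure_pmf.prob (convolve_pmf W (map_pmf ((*) q) Y)) E = measure_pmf.prob W E"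
proof -
  have "measure_pmf.prob (convolve_pmf W (map_pmf ((*) q) Y)) E =
      measure_pmf.prob (pair_pmf W Y) (fst -` E)"
    unfolding convolve_pmf_def pair_map_pmf2 pmf.map_comp measure_map_pmf
    by (rule arg_cong[where f = "measure_pmf.prob _"]) (auto simp: assms)
  also have "\<dots> = measure_pmf.prob (map_pmf fst (pair_pmf W Y)) E" by simp
  finally show ?thesis by (simp only: map_fst_pair_pmf)
qed

lemma prob_convolve_le:
  assumes "\<And>x. measure_pmf.prob S ((\<lambda>y. y + x) -` A) \<le> b"
  shows "measure_pmf.prob (convolve_pmf S T) A \<le> b"
proof -
  have "0 \<le> b" by (rule order_trans[OF measure_nonneg assms])
  have "emeasure (convolve_pmf S T) A = (\<integral>\<^sup>+x. emeasure (map_pmf ((+) x) S) A \<partial>measure_pmf T)"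
    by (subst convolve_pmf_commute) (simp add: convolve_pmf_altdef)
  also have "\<dots> \<le> (\<integral>\<^sup>+x. ennreal b \<partial>measure_pmf T)"
    using assms
    by (intro nn_integral_mono) (simp add: measure_pmf.emeasure_eq_measure ennreal_leI add.commute)
  also have "\<dots> = ennreal b" by (simp add: measure_pmf.emeasure_space_1)
  finally show ?thesis using \<open>0 \<le> b\<close> by (simp add: measure_pmf.emeasure_eq_measure)
qed

section \<open>Sums of two binomials at different scales\<close>

definition two_scale_sum :: "int \<Rightarrow> nat \<Rightarrow> nat \<Rightarrow> int pmf" where
  "two_scale_sum p L M = convolve_pmf (fair_binomial (L\<^sup>2)) (map_pmf ((*) p) (fair_binomial (M\<^sup>2)))"

lemma two_scale_sum_altdef:
  "two_scale_sum p L M =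
    map_pmf (\<lambda>(u, v). u + p * v) (pair_pmf (fair_binomial (L\<^sup>2)) (fair_binomial (M\<^sup>2)))"
  by (simp add: two_scale_sum_def convolve_pmf_def pair_map_pmf2 pmf.map_comp o_def
    case_prod_unfold)

lemma set_pmf_two_scale_sum:
  assumes "0 \<le> p"
  shows "set_pmf (two_scale_sum p L M) \<subseteq> {0..2 * (int L)\<^sup>2 + p * (2 * (int M)\<^sup>2)}"
  using assms
  by (auto simp: two_scale_sum_altdef set_pmf_fair_binomial intro!: add_mono mult_left_mono)

lemma prob_two_scale_sum_residue_le:
  assumes lattice: "no_short_vectors p q L M" and pos: "0 < L" "0 < M"
  shows "measure_pmf.prob (two_scale_sum p L M) {w. w mod q = s} \<le> 9 / (real L * real M)"
proof -
  let ?D = "{(u, v). (u + p * v) mod q = s}"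
  have "int L \<le> \<bar>u - u'\<bar> \<or> int M \<le> \<bar>v - v'\<bar>"
    if "(u, v) \<in> ?D" "(u', v') \<in> ?D" "(u, v) \<noteq> (u', v')" for u v u' v'
  proof -
    have "(u + p * v) mod q = (u' + p * v') mod q" using that by simp
    then have "q dvd (u - u') + p * (v - v')" by (simp add: mod_eq_dvd_iff algebra_simps)
    then show ?thesis using no_short_vectorsD[OF lattice] that(3) by fastforce
  qed
  then have "pairwise (\<lambda>(u, v) (u', v'). int L \<le> \<bar>u - u'\<bar> \<or> int M \<le> \<bar>v - v'\<bar>) ?D"
    by (auto simp: pairwise_def)
  then have "measure_pmf.prob (pair_pmf (fair_binomial (L\<^sup>2)) (fair_binomial (M\<^sup>2))) ?D \<le>
      3 * 3 / (int L * int M)"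
    using pos by (intro prob_pair_box_separated_le smooth_at_scale_fair_binomial) auto
  then show ?thesis by (simp add: two_scale_sum_altdef vimage_def case_prod_unfold)
qed

definition typical_residues :: "int \<Rightarrow> int \<Rightarrow> nat \<Rightarrow> nat \<Rightarrow> int set" where
  "typical_residues p q L M = {x. \<exists>u v. \<bar>u - int (L\<^sup>2)\<bar> \<le> 2 * int L \<and>
    \<bar>v - int (M\<^sup>2)\<bar> \<le> 2 * int M \<and> q dvd x - (u + p * v)}"

lemma typical_residues_periodic:
  "x + q * y \<in> typical_residues p q L M \<longleftrightarrow> x \<in> typical_residues p q L M"
proof -
  have "q dvd x + q * y - z \<longleftrightarrow> q dvd x - z" for z
    using dvd_add_times_triv_right_iff[of q "x - z" y] by (simp add: algebra_simps)
  then show ?thesis by (simp add: typical_residues_def)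
qed

lemma prob_typical_residues_ge:
  assumes pos: "0 < L" "0 < M"
  shows "49 / 64 \<le> measure_pmf.prob (two_scale_sum p L M) (typical_residues p q L M)"
proof -
  let ?U = "fair_binomial (L\<^sup>2)" and ?V = "fair_binomial (M\<^sup>2)"
  let ?I = "\<lambda>L. {x. \<bar>x - int (L\<^sup>2)\<bar> \<le> 2 * int L}"
  have "49 / 64 = 7 / 8 * (7 / 8 :: real)" by simp
  also have "\<dots> \<le> measure_pmf.prob ?U (?I L) * measure_pmf.prob ?V (?I M)"
    by (intro mult_mono fair_binomial_within_two_sqrt pos) auto
  also have "\<dots> = measure_pmf.prob (pair_pmf ?U ?V) (?I L \<times> ?I M)"
    by (rule measure_pmf_prob_product[symmetric]) auto
  also have "\<dots> \<le> measure_pmf.prob (two_scale_sum p L M) (typical_residues p q L M)"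
    unfolding two_scale_sum_altdef measure_map_pmf
    by (rule measure_pmf.finite_measure_mono) (force simp: typical_residues_def)+
  finally show ?thesis .
qed

lemma typical_residues_windows:
  assumes lattice: "no_short_vectors p q l l'" and wide: "4 * int M < l'"
  obtains Z where "separated l Z"
    and "typical_residues p q L M \<subseteq> (\<Union>t\<in>{0..<4 * int L + 1}. (+) t ` Z)"
proof
  let ?left = "int (L\<^sup>2) - 2 * int L"
  let ?Z = "{z. \<exists>v. \<bar>v - int (M\<^sup>2)\<bar> \<le> 2 * int M \<and> q dvd z - (?left + p * v)}"
  show "separated l ?Z"
    unfolding separated_def
  proof (rule pairwiseI)
    fix z z' assume "z \<in> ?Z" "z' \<in> ?Z" "z \<noteq> z'"
    then obtain v v' where close: "\<bar>v - int (M\<^sup>2)\<bar> \<le> 2 * int M" "\<bar>v' - int (M\<^sup>2)\<bar> \<le> 2 * int M"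
      and residue: "q dvd z - (?left + p * v)" "q dvd z' - (?left + p * v')"
      by blast
    have "q dvd (z - z') + p * (v' - v)"
      using dvd_diff[OF residue] by (simp add: algebra_simps)
    moreover have "\<bar>v' - v\<bar> < l'" using close wide by linarith
    ultimately show "l \<le> \<bar>z - z'\<bar>"
      using no_short_vectorsD(1)[OF lattice] \<open>z \<noteq> z'\<close> by fastforce
  qed
  show "typical_residues p q L M \<subseteq> (\<Union>t\<in>{0..<4 * int L + 1}. (+) t ` ?Z)"
  proof
    fix x assume "x \<in> typical_residues p q L M"
    then obtain u v where "\<bar>u - int (L\<^sup>2)\<bar> \<le> 2 * int L"
      and "\<bar>v - int (M\<^sup>2)\<bar> \<le> 2 * int M" "q dvd x - (u + p * v)"
      unfolding typical_residues_def by auto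
    then have "u - ?left \<in> {0..<4 * int L + 1}" "x - (u - ?left) \<in> ?Z"
      by (auto simp: algebra_simps)
    then show "x \<in> (\<Union>t\<in>{0..<4 * int L + 1}. (+) t ` ?Z)"
      by (intro UN_I[of "u - ?left"] image_eqI[of _ _ "x - (u - ?left)"]) auto
  qed
qed

lemma prob_convolve_typical_residues_le:
  assumes "no_short_vectors p q l l'" "4 * int M < l'" "0 < l"
    and smooth: "smooth_at_scale l C S"
  shows "measure_pmf.prob (convolve_pmf S T) (typical_residues p q L M) \<le>
    (4 * real L + 1) * (C / l)"
proof (rule prob_convolve_le)
  fix x
  obtain Z where separated: "separated l Z"
    and windows: "typical_residues p q L M \<subseteq> (\<Union>t\<in>{0..<4 * int L + 1}. (+) t ` Z)"
    using typical_residues_windows[OF assms(1,2)] .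
  have "(\<lambda>y. y + x) -` typical_residues p q L M \<subseteq>
      (\<Union>t\<in>{0..<4 * int L + 1}. (+) t ` (+) (- x) ` Z)"
    using windows by (force simp: image_iff)
  then have "measure_pmf.prob S ((\<lambda>y. y + x) -` typical_residues p q L M) \<le>
      measure_pmf.prob S (\<Union>t\<in>{0..<4 * int L + 1}. (+) t ` (+) (- x) ` Z)"
    by (intro measure_pmf.finite_measure_mono) auto
  also have "\<dots> \<le> real_of_int (4 * int L + 1) * (C / l)"
    using \<open>0 < l\<close> by (intro prob_separated_windows_le smooth separated_translate separated) auto
  finally show "measure_pmf.prob S ((\<lambda>y. y + x) -` typical_residues p q L M) \<le>
      (4 * real L + 1) * (C / l)" by simp
qed

section \<open>The hypotheses\<close>

definition three_scale_sum :: "int \<Rightarrow> int \<Rightarrow> nat \<Rightarrow> nat \<Rightarrow> nat \<Rightarrow> int pmf" where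
  "three_scale_sum p q L M K =
    convolve_pmf (two_scale_sum p L M) (map_pmf ((*) q) (fair_binomial (K\<^sup>2)))"

lemma is_A_sum_three_scale_sum:
  assumes "2 * (L\<^sup>2 + M\<^sup>2 + K\<^sup>2) \<le> N"
  shows "is_A_sum {0, 1, p, q} N (three_scale_sum p q L M K)"
proof (rule is_A_sum_mono)
  have "map_pmf ((*) 1) (fair_binomial (L\<^sup>2)) = fair_binomial (L\<^sup>2)"
    by (rule map_pmf_idI) simp
  then have "is_A_sum {0, 1, p, q} (2 * L\<^sup>2) (fair_binomial (L\<^sup>2))"
    using is_A_sum_fair_binomial[of "{0, 1, p, q}" 1 "L\<^sup>2"] by simp
  then show "is_A_sum {0, 1, p, q} (2 * L\<^sup>2 + 2 * M\<^sup>2 + 2 * K\<^sup>2) (three_scale_sum p q L M K)"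
    unfolding three_scale_sum_def two_scale_sum_def
    by (intro is_A_sum_convolve is_A_sum_fair_binomial) auto
qed (use assms in auto)

lemma three_scale_sum_dominated:
  fixes p q :: int
  assumes "0 \<le> p" "0 < q" "0 < K"
  obtains R where "\<And>L M. no_short_vectors p q L M \<Longrightarrow> 0 < L \<Longrightarrow> 0 < M \<Longrightarrow>
      2 * (int L)\<^sup>2 + p * (2 * (int M)\<^sup>2) < q * int K \<Longrightarrow>
      dominated (27 * real_of_int q / (real L * real M)) (three_scale_sum p q L M K) R"
proof -
  have "smooth_at_scale (int K) 3 (fair_binomial (K\<^sup>2))"
    using \<open>0 < K\<close> by (intro smooth_at_scale_fair_binomial) auto
  then obtain Q where translate: "\<And>t. t \<in> {0..<int K} \<Longrightarrow>
      dominated 3 (map_pmf ((+) t) (fair_binomial (K\<^sup>2))) Q"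
    unfolding smooth_at_scale_def by blast
  show thesis
  proof (rule that)
    fix L M :: nat
    assume scales: "no_short_vectors p q L M" "0 < L" "0 < M"
      and wide: "2 * (int L)\<^sup>2 + p * (2 * (int M)\<^sup>2) < q * int K"
    have "w div q \<in> {0..<int K}" if "w \<in> set_pmf (two_scale_sum p L M)" for w
    proof -
      have range: "0 \<le> w" "w < q * int K"
        using set_pmf_two_scale_sum[OF \<open>0 \<le> p\<close>, of L M] that wide by auto
      have "q * (w div q) \<le> w" using \<open>0 < q\<close> by (simp flip: minus_mod_eq_mult_div)
      then have "q * (w div q) < q * int K" using range by linarith
      then show ?thesis using range \<open>0 < q\<close> by (simp add: pos_imp_zdiv_nonneg_iff)
    qed
    then have "dominated (3 * (9 * real_of_int q / (real L * real M))) (three_scale_sum p q L M K)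
        (convolve_pmf (pmf_of_set {0..<q}) (map_pmf ((*) q) Q))"
      unfolding three_scale_sum_def
      using prob_two_scale_sum_residue_le[OF scales] \<open>0 < q\<close>
      by (intro convolve_multiples_dominated translate) auto
    then show "dominated (27 * real_of_int q / (real L * real M)) (three_scale_sum p q L M K)
        (convolve_pmf (pmf_of_set {0..<q}) (map_pmf ((*) q) Q))" by simp
  qed
qed

lemma dTV_three_scale_sum_ge:
  assumes "no_short_vectors p q l l'" "0 < l" "4 * int M < l'" "l \<le> int L'" "0 < L" "0 < M"
  shows "49 / 64 - (4 * real L + 1) * (3 / l) \<le>
    dTV (three_scale_sum p q L M K) (three_scale_sum p q L' M' K')"
proof -
  let ?E = "typical_residues p q L M"
  have periodic: "measure_pmf.prob (three_scale_sum p q L\<^sub>0 M\<^sub>0 K\<^sub>0) ?E =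
      measure_pmf.prob (two_scale_sum p L\<^sub>0 M\<^sub>0) ?E" for L\<^sub>0 M\<^sub>0 K\<^sub>0
    unfolding three_scale_sum_def
    by (rule prob_convolve_multiples_periodic) (rule typical_residues_periodic)
  have "49 / 64 \<le> measure_pmf.prob (three_scale_sum p q L M K) ?E"
    unfolding periodic by (rule prob_typical_residues_ge) fact+
  moreover have "smooth_at_scale l 3 (fair_binomial (L'\<^sup>2))"
    using assms by (intro smooth_at_scale_fair_binomial) (auto intro: power_mono)
  then have "measure_pmf.prob (three_scale_sum p q L' M' K') ?E \<le> (4 * real L + 1) * (3 / l)"
    unfolding periodic two_scale_sum_def
    using assms by (intro prob_convolve_typical_residues_le) auto
  ultimately show ?thesis
    using prob_diff_le_dTV[of "three_scale_sum p q L M K" ?E "three_scale_sum p q L' M' K'"]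
    by linarith
qed

text \<open>Each of the three binomials contributes a factor \<open>3\<close>, and \<open>F (n + 1) / (F (n - k) F k)\<close>
  the rest.\<close>
definition domination_factor :: "nat \<Rightarrow> real" where
  "domination_factor a = 27 * ((real a + 1)\<^sup>2 + 1)"

lemma domination_factor_gt_1: "1 < domination_factor a"
  unfolding domination_factor_def by (rule less_le_trans[of _ 27]) auto

lemma sum_of_scales_less:
  fixes L M p q :: nat
  assumes "L < q" "M \<le> q" "p \<le> q"
  shows "2 * L\<^sup>2 + p * (2 * M\<^sup>2) < q * (4 * q\<^sup>2)"
proof -
  have "L\<^sup>2 < q\<^sup>2" using assms by (intro power_strict_mono) auto
  also have "\<dots> \<le> q * q\<^sup>2" using assms by simp
  finally have "2 * L\<^sup>2 < 2 * (q * q\<^sup>2)" by simp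
  moreover have "p * M\<^sup>2 \<le> q * q\<^sup>2" using assms by (intro mult_le_mono power_mono) auto
  ultimately show ?thesis by linarith
qed

text \<open>The width \<open>4 q\<^sup>2\<close> of the third binomial exceeds the range of the sum of the other two
  divided by \<open>q\<close>.\<close>
definition fib_hypothesis :: "nat \<Rightarrow> nat \<Rightarrow> nat \<Rightarrow> int pmf" where
  "fib_hypothesis a n k = three_scale_sum (fib_poly a n) (fib_poly a (Suc n))
    (fib_poly a (n - k)) (fib_poly a k) (4 * (fib_poly a (Suc n))\<^sup>2)"

lemma fib_hypothesis_dominated:
  assumes a_gt_1: "1 < a"
  obtains R where "\<And>k. k \<in> {0<..<n} \<Longrightarrow> dominated (domination_factor a) (fib_hypothesis a n k) R"
proof -
  define p q where "p = fib_poly a n" and "q = fib_poly a (Suc n)"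
  have "0 < q" unfolding q_def using a_gt_1 by (intro fib_poly_pos) auto
  then obtain R where reference: "\<And>L M. no_short_vectors p q L M \<Longrightarrow> 0 < L \<Longrightarrow> 0 < M \<Longrightarrow>
      2 * (int L)\<^sup>2 + p * (2 * (int M)\<^sup>2) < q * int (4 * q\<^sup>2) \<Longrightarrow>
      dominated (27 * real q / (real L * real M)) (three_scale_sum p q L M (4 * q\<^sup>2)) R"
    using three_scale_sum_dominated[of "int p" "int q" "4 * q\<^sup>2"] by auto
  have "dominated (domination_factor a) (fib_hypothesis a n k) R" if k_mem: "k \<in> {0<..<n}" for k
  proof -
    define L M where "L = fib_poly a (n - k)" and "M = fib_poly a k"
    have pos: "0 < L" "0 < M"
      unfolding L_def M_def using a_gt_1 k_mem by (auto intro!: fib_poly_pos)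
    have "L < q" "M < q" "p < q"
      unfolding L_def M_def p_def q_def
      using k_mem by (auto intro!: strict_monoD[OF strict_mono_fib_poly[OF a_gt_1]])
    then have "2 * L\<^sup>2 + p * (2 * M\<^sup>2) < q * (4 * q\<^sup>2)" by (intro sum_of_scales_less) auto
    then have "int (2 * L\<^sup>2 + p * (2 * M\<^sup>2)) < int (q * (4 * q\<^sup>2))" by (simp only: of_nat_less_iff)
    moreover have "no_short_vectors p q L M"
      unfolding p_def q_def L_def M_def using a_gt_1 k_mem
      by (intro no_short_vectors_fib_poly_diff) auto
    ultimately have "dominated (27 * real q / (real L * real M))
        (three_scale_sum p q L M (4 * q\<^sup>2)) R"
      using pos by (intro reference) auto
    moreover have "27 * real q \<le> domination_factor a * (real L * real M)"
      using of_nat_mono[where 'a = real, OF fib_poly_Suc_le_mult[of a k n]] a_gt_1 k_mem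
      by (simp add: domination_factor_def q_def L_def M_def algebra_simps)
    then have "27 * real q / (real L * real M) \<le> domination_factor a"
      using pos by (simp add: divide_le_eq)
    ultimately show ?thesis
      unfolding fib_hypothesis_def p_def q_def L_def M_def by (rule dominated_mono)
  qed
  then show thesis by (rule that)
qed

lemma dTV_fib_hypothesis_gt:
  assumes a_ge: "30 \<le> a" and order: "0 < j" "j < k" "k < n"
  shows "1 / 5 < dTV (fib_hypothesis a n k) (fib_hypothesis a n j)"
proof -
  define L l where "L = fib_poly a (n - k)" and "l = fib_poly a (Suc n - k)"
  have pos: "0 < L" "0 < fib_poly a k"
    unfolding L_def using a_ge order by (auto intro!: fib_poly_pos)
  have growth: "30 * fib_poly a i \<le> fib_poly a (Suc i)" for i
    using order_trans[OF mult_le_mono1[OF a_ge] mult_fib_poly_le_Suc] .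
  have "30 * L \<le> l"
    unfolding L_def l_def using growth[of "n - k"] order by (simp add: Suc_diff_le)
  have "4 * fib_poly a k < fib_poly a (Suc k)" using growth[of k] pos by linarith
  moreover have "l \<le> fib_poly a (n - j)"
    unfolding l_def using a_ge order by (simp add: strict_mono_less_eq[OF strict_mono_fib_poly])
  moreover have "no_short_vectors (fib_poly a n) (fib_poly a (Suc n)) l (fib_poly a (Suc k))"
    unfolding l_def using a_ge order by (intro no_short_vectors_fib_poly) auto
  ultimately have "49 / 64 - (4 * real L + 1) * (3 / l) \<le>
      dTV (fib_hypothesis a n k) (fib_hypothesis a n j)"
    unfolding fib_hypothesis_def L_def[symmetric] using pos \<open>30 * L \<le> l\<close>
    by (intro order_trans[OF _ dTV_three_scale_sum_ge]) auto
  moreover have "(4 * real L + 1) * (3 / l) \<le> (5 * real L) * (3 / (30 * real L))"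
  proof (intro mult_mono divide_left_mono)
    show "30 * real L \<le> real l" using \<open>30 * L \<le> l\<close> by linarith
  qed (use pos \<open>30 * L \<le> l\<close> in auto)
  moreover have "(5 * real L) * (3 / (30 * real L)) = 1 / 2" using pos by simp
  ultimately show ?thesis by linarith
qed

lemma fib_hypothesis_pairwise_far:
  assumes "30 \<le> a" "j \<in> {0<..<n}" "k \<in> {0<..<n}" "j \<noteq> k"
  shows "1 / 5 < dTV (fib_hypothesis a n j) (fib_hypothesis a n k)"
  using assms dTV_fib_hypothesis_gt dTV_commute by (metis greaterThanLessThan_iff nat_neq_iff)

section \<open>The sample lower bound\<close>

definition fib_quadruple :: "nat \<Rightarrow> nat \<Rightarrow> int \<times> int \<times> int \<times> int" where
  "fib_quadruple a n = (0, 1, int (fib_poly a n), int (fib_poly a (Suc n)))"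

lemma eventually_is_A_sum_fib_hypothesis:
  "\<forall>\<^sub>F N in sequentially.
    is_A_sum {0, 1, fib_poly a n, fib_poly a (Suc n)} N (fib_hypothesis a n k)"
  unfolding fib_hypothesis_def eventually_sequentially
  by (intro exI allI impI is_A_sum_three_scale_sum)

lemma correct_learner_pow_samples_ge:
  assumes learner: "correct_learner m alg" and a_ge: "30 \<le> a" and n_gt_1: "1 < n"
  shows "\<forall>\<^sub>F N in sequentially. 9 / 10 * real (n - 1) \<le>
    domination_factor a ^ m N (1 / 10) (fib_quadruple a n)"
proof -
  let ?S = "fib_hypothesis a n"
  obtain R where dominated: "\<And>k. k \<in> {0<..<n} \<Longrightarrow> dominated (domination_factor a) (?S k) R"
    using fib_hypothesis_dominated[of a n] a_ge by auto
  have "\<forall>\<^sub>F N in sequentially. \<forall>k\<in>{0<..<n}.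
      is_A_sum {0, 1, fib_poly a n, fib_poly a (Suc n)} N (?S k)"
    by (intro eventually_ball_finite ballI eventually_is_A_sum_fib_hypothesis) auto
  then show ?thesis
  proof eventually_elim
    case (elim N)
    have "9 / 10 * real (card {0<..<n}) \<le>
        domination_factor a ^ m N (1 / 10) (fib_quadruple a n)"
    proof (rule learning_dominated_hypotheses_bound[OF _ _ dominated])
      show "2 * (1 / 10) < dTV (?S i) (?S j)" if "i \<in> {0<..<n}" "j \<in> {0<..<n}" "i \<noteq> j" for i j
        using fib_hypothesis_pairwise_far[OF a_ge that] by simp
      show "9 / 10 \<le> measure_pmf.prob
          (bind_pmf (iid_pmf (m N (1 / 10) (fib_quadruple a n)) (?S k))
            (alg N (1 / 10) (fib_quadruple a n)))
          {H. dTV H (?S k) \<le> 1 / 10}" if "k \<in> {0<..<n}" for k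
        unfolding fib_quadruple_def
        using elim that a_ge n_gt_1 fib_poly_increasing[of a n]
        by (intro learner[unfolded correct_learner_def, rule_format]) auto
    qed (use domination_factor_gt_1[of a] in auto)
    then show ?case by simp
  qed
qed

lemma ln_ln_fib_poly_le:
  assumes "1 < a"
  shows "\<forall>\<^sub>F n in sequentially. ln (ln (fib_poly a (Suc n))) \<le> 2 * ln (9 / 10 * real (n - 1))"
proof -
  have "\<forall>\<^sub>F n in sequentially. real n * ln (real a + 1) \<le> (9 / 10 * (real n - 1))\<^sup>2"
    using assms by real_asymp
  then show ?thesis
    using eventually_gt_at_top[of 1]
  proof eventually_elim
    case (elim n)
    let ?q = "real (fib_poly a (Suc n))"
    have "1 < ?q" using fib_poly_increasing[OF assms elim(2)] by simp
    have "?q \<le> real ((a + 1) ^ n)"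
      using fib_poly_Suc_le_power[of a n] assms by (simp only: of_nat_le_iff)
    then have "ln ?q \<le> ln ((real a + 1) ^ n)"
      using \<open>1 < ?q\<close> by (subst ln_le_cancel_iff) (auto simp: add.commute)
    also have "\<dots> = real n * ln (real a + 1)" by (rule ln_realpow)
    also have "\<dots> \<le> (9 / 10 * real (n - 1))\<^sup>2" using elim by simp
    finally have "ln (ln ?q) \<le> ln ((9 / 10 * real (n - 1))\<^sup>2)"
      using \<open>1 < ?q\<close> elim by (subst ln_le_cancel_iff) auto
    also have "\<dots> = 2 * ln (9 / 10 * real (n - 1))" using elim by (subst ln_realpow) auto
    finally show ?case .
  qed
qed

lemma correct_learner_samples_ge:
  assumes learner: "correct_learner m alg" and a_ge: "30 \<le> a"
  shows "\<forall>\<^sub>F n in sequentially. \<forall>\<^sub>F N in sequentially.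
    1 / (2 * ln (domination_factor a)) * ln (ln (fib_poly a (Suc n))) \<le>
    real (m N (1 / 10) (fib_quadruple a n))"
proof -
  let ?C = "domination_factor a"
  have "\<forall>\<^sub>F n in sequentially. ln (ln (fib_poly a (Suc n))) \<le> 2 * ln (9 / 10 * real (n - 1))"
    using a_ge by (intro ln_ln_fib_poly_le) simp
  then show ?thesis
    using eventually_gt_at_top[of 1]
  proof eventually_elim
    case (elim n)
    have "\<forall>\<^sub>F N in sequentially. 9 / 10 * real (n - 1) \<le> ?C ^ m N (1 / 10) (fib_quadruple a n)"
      by (rule correct_learner_pow_samples_ge[OF learner a_ge elim(2)])
    then show ?case
    proof eventually_elim
      case (elim N)
      let ?m = "m N (1 / 10) (fib_quadruple a n)"
      have "ln (9 / 10 * real (n - 1)) \<le> ln (?C ^ ?m)"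
        using elim \<open>1 < n\<close> domination_factor_gt_1[of a] by (subst ln_le_cancel_iff) auto
      also have "\<dots> = real ?m * ln ?C" by (rule ln_realpow)
      finally have "ln (ln (fib_poly a (Suc n))) \<le> 2 * (real ?m * ln ?C)"
        using \<open>ln (ln (fib_poly a (Suc n))) \<le> _\<close> by linarith
      then show ?case using domination_factor_gt_1[of a] by (simp add: field_simps)
    qed
  qed
qed

lemma inj_fib_quadruple: "1 < a \<Longrightarrow> inj (fib_quadruple a)"
  using strict_mono_eq[OF strict_mono_fib_poly] by (simp add: fib_quadruple_def inj_def)

lemma infinite_if_eventually_mem:
  fixes f :: "nat \<Rightarrow> 'a"
  assumes "inj f" "\<forall>\<^sub>F n in sequentially. f n \<in> S"
  shows "infinite S"
proof -
  obtain n0 where "\<And>n. n0 \<le> n \<Longrightarrow> f n \<in> S"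
    using assms(2) unfolding eventually_sequentially by blast
  then have "f ` {n0..} \<subseteq> S" by auto
  moreover have "infinite (f ` {n0..})"
    using assms(1) by (simp add: finite_image_iff inj_on_subset infinite_Ici)
  ultimately show ?thesis using finite_subset by blast
qed

theorem theorem5:
  shows "\<exists>c > 0. \<exists>eps0 > 0. \<forall>m alg. correct_learner m alg \<longrightarrow>
    infinite {(a1 :: int, a2 :: int, a3 :: int, a4 :: int).
      0 \<le> a1 \<and> a1 < a2 \<and> a2 < a3 \<and> a3 < a4 \<and>
      (\<forall>\<^sub>F N in sequentially.
         real (m N eps0 (a1, a2, a3, a4)) \<ge> c * ln (ln (real_of_int a4)))}"
proof (rule exI[of _ "1 / (2 * ln (domination_factor 30))"],
    intro conjI exI[of _ "1 / 10"] allI impI)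
  fix m alg assume learner: "correct_learner m alg"
  let ?c = "1 / (2 * ln (domination_factor 30))"
  let ?S = "{(a1 :: int, a2 :: int, a3 :: int, a4 :: int).
      0 \<le> a1 \<and> a1 < a2 \<and> a2 < a3 \<and> a3 < a4 \<and>
      (\<forall>\<^sub>F N in sequentially.
         real (m N (1 / 10) (a1, a2, a3, a4)) \<ge> ?c * ln (ln (real_of_int a4)))}"
  have "\<forall>\<^sub>F n in sequentially. fib_quadruple 30 n \<in> ?S"
    using correct_learner_samples_ge[OF learner order_refl] eventually_gt_at_top[of 1]
  proof eventually_elim
    case (elim n)
    then show ?case using fib_poly_increasing[of 30 n] by (simp add: fib_quadruple_def)
  qed
  with inj_fib_quadruple[of 30] show "infinite ?S" by (intro infinite_if_eventually_mem) auto
qed (use domination_factor_gt_1[of 30] in auto)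

end
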